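(* Let $X$ be an orientable map and let $u,v$ be distinct vertices of $X$ of equal degree. Assume that there is perfect state transfer from $u$ to $v$ at time $\tau\in\mathbb{Z}_{>0}$. Then: (i) there is perfect state transfer from $v$ to $u$ at time $\tau$; (ii) $X$ is periodic at both $u$ and $v$ at time $2\tau$; (iii) there is no vertex $w$, distinct from $u$ and $v$, such that there is perfect state transfer from $u$ to $w$ at any time; (iv) $u$ and $v$ are strongly cospectral with respect to $B_d$ for every positive divisor $d$ of $\tau$.
   Context: An orientable map $X$ is a 2-cell embedding of a finite connected multigraph (loops and parallel edges allowed) in a closed orientable surface, with vertex set $V$, edge set $E$ and face set $F$. Each edge gives rise to two arcs lying on opposite sides of the edge and pointing in opposite directions; each arc lies in a face and is oriented along the clockwise facial boundary walk of that face. Let $\mathcal{A}$ be the set of arcs; for $a\in\mathcal{A}$ let $v(a)$ be its tail vertex and $f(a)$ the face in which it lies. Let $N\in\{0,1\}^{\mathcal A\times V}$ with $N(a,v)=1$ iff $v=v(a)$, and $M\in\{0,1\}^{\mathcal A\times F}$ with $M(a,f)=1$ iff $f=f(a)$. Let $D=N^TN$ and $\Delta=M^TM$ (diagonal matrices of vertex degrees and face degrees). Put $\hat N=ND^{-1/2}$, $\hat M=M\Delta^{-1/2}$, $Q=\hat N\hat N^T$, $P=\hat M\hat M^T$, and $U=(2P-I)(2Q-I)$ (the transition matrix of the vertex-face walk). For $t\ge0$ let $B_t=\hat N^TU^t\hat N$. For $w\in V$, $e_w$ is the standard basis vector of $\mathbb{C}^V$. For distinct vertices $u,v$ of equal degree,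 there is perfect state transfer from $u$ to $v$ at time $\tau>0$ if $U^\tau\hat Ne_u=\hat Ne_v$; $X$ is periodic at vertex $u$ at time $\tau$ if $U^\tau\hat Ne_u=\hat Ne_u$. For a Hermitian matrix $H$ with spectral decomposition $H=\sum_r\theta_rE_r$, indices $u,v$ are strongly cospectral with respect to $H$ if $E_re_v=\pm E_re_u$ for all $r$. *)

theory Defs
  imports "HOL-Complex_Analysis.Complex_Analysis"
begin

section \<open>Closed oriented surfaces\<close>

definition chart :: "'s topology \<Rightarrow> 's set \<Rightarrow> ('s \<Rightarrow> complex) \<Rightarrow> bool" where
  "chart S U \<phi> \<longleftrightarrow> openin S U \<and> open (\<phi> ` U) \<and>
     homeomorphic_map (subtopology S U) (top_of_set (\<phi> ` U)) \<phi>"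

text \<open>Meant for an injective continuous \<open>h\<close> on an open set \<open>W\<close> of the plane: such an \<open>h\<close>
  preserves orientation iff it maps every small anticlockwise circle around a point to a loop
  winding once anticlockwise around the image of that point.\<close>

definition orientation_preserving_on :: "complex set \<Rightarrow> (complex \<Rightarrow> complex) \<Rightarrow> bool" where
  "orientation_preserving_on W h \<longleftrightarrow>
     (\<forall>z r. 0 < r \<longrightarrow> cball z r \<subseteq> W \<longrightarrow> winding_number (h \<circ> circlepath z r) (h z) = 1)"

definition compatible_charts ::
    "'s set \<Rightarrow> ('s \<Rightarrow> complex) \<Rightarrow> 's set \<Rightarrow> ('s \<Rightarrow> complex) \<Rightarrow> bool" where
  "compatible_charts U \<phi> U' \<phi>' \<longleftrightarrow>
     orientation_preserving_on (\<phi> ` (U \<inter> U')) (\<phi>' \<circ> inv_into U \<phi>)"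

definition oriented_atlas :: "'s topology \<Rightarrow> ('s set \<times> ('s \<Rightarrow> complex)) set \<Rightarrow> bool" where
  "oriented_atlas S A \<longleftrightarrow>
     (\<forall>(U, \<phi>) \<in> A. chart S U \<phi>) \<and>
     topspace S \<subseteq> (\<Union>(U, \<phi>) \<in> A. U) \<and>
     (\<forall>(U, \<phi>) \<in> A. \<forall>(U', \<phi>') \<in> A. compatible_charts U \<phi> U' \<phi>')"

definition closed_oriented_surface ::
    "'s topology \<Rightarrow> ('s set \<times> ('s \<Rightarrow> complex)) set \<Rightarrow> bool" where
  "closed_oriented_surface S A \<longleftrightarrow>
     compact_space S \<and> connected_space S \<and> Hausdorff_space S \<and> oriented_atlas S A"

definition positive_chart ::
    "'s topology \<Rightarrow> ('s set \<times> ('s \<Rightarrow> complex)) set \<Rightarrow> 's set \<Rightarrow> ('s \<Rightarrow> complex) \<Rightarrow> bool" where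
  "positive_chart S A U \<phi> \<longleftrightarrow>
     chart S U \<phi> \<and> (\<forall>(U', \<phi>') \<in> A. compatible_charts U \<phi> U' \<phi>')"


section \<open>Orientable maps\<close>

text \<open>The finite types \<open>'v\<close>, \<open>'e\<close>, \<open>'f\<close> are the vertex, edge and face sets. The multigraph is given
  by the two ends of each edge, listed in an arbitrary order. The orientation of the surface,
  relative to which \<open>clockwise\<close> is understood, is the one given by the atlas.\<close>

record ('s, 'v, 'e, 'f) omap =
  surface :: "'s topology"
  atlas :: "('s set \<times> ('s \<Rightarrow> complex)) set"
  end0 :: "'e \<Rightarrow> 'v"
  end1 :: "'e \<Rightarrow> 'v"
  point :: "'v \<Rightarrow> 's"
  curve :: "'e \<Rightarrow> real \<Rightarrow> 's"
  region :: "'f \<Rightarrow> 's set"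

text \<open>The arc \<open>(e, True)\<close> runs along the edge \<open>e\<close> from \<open>end0 e\<close> to \<open>end1 e\<close>, the arc
  \<open>(e, False)\<close> runs in the opposite direction.\<close>

type_synonym 'e arc = "'e \<times> bool"

definition tail :: "('s, 'v, 'e, 'f) omap \<Rightarrow> 'e arc \<Rightarrow> 'v" where
  "tail X a = (if snd a then end0 X (fst a) else end1 X (fst a))"

definition head :: "('s, 'v, 'e, 'f) omap \<Rightarrow> 'e arc \<Rightarrow> 'v" where
  "head X a = (if snd a then end1 X (fst a) else end0 X (fst a))"

definition arc_curve :: "('s, 'v, 'e, 'f) omap \<Rightarrow> 'e arc \<Rightarrow> real \<Rightarrow> 's" where
  "arc_curve X a t = curve X (fst a) (if snd a then t else 1 - t)"

definition connected_multigraph :: "('s, 'v, 'e, 'f) omap \<Rightarrow> bool" where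
  "connected_multigraph X \<longleftrightarrow> (\<forall>x y. (x, y) \<in> (range (\<lambda>a. (tail X a, head X a)))\<^sup>*)"

definition embedded_multigraph :: "('s, 'v, 'e, 'f) omap \<Rightarrow> bool" where
  "embedded_multigraph X \<longleftrightarrow>
     inj (point X) \<and> range (point X) \<subseteq> topspace (surface X) \<and>
     (\<forall>e. pathin (surface X) (curve X e) \<and>
          curve X e 0 = point X (end0 X e) \<and> curve X e 1 = point X (end1 X e) \<and>
          inj_on (curve X e) {0<..<1} \<and>
          curve X e ` {0<..<1} \<inter> range (point X) = {}) \<and>
     (\<forall>e e'. e \<noteq> e' \<longrightarrow> curve X e ` {0<..<1} \<inter> curve X e' ` {0<..<1} = {})"

definition drawing :: "('s, 'v, 'e, 'f) omap \<Rightarrow> 's set" where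
  "drawing X = range (point X) \<union> (\<Union>e. curve X e ` {0..1})"

definition orientable_map :: "('s, 'v::finite, 'e::finite, 'f::finite) omap \<Rightarrow> bool" where
  "orientable_map X \<longleftrightarrow>
     closed_oriented_surface (surface X) (atlas X) \<and>
     connected_multigraph X \<and> embedded_multigraph X \<and>
     bij_betw (region X) UNIV
       (connected_components_of (subtopology (surface X) (topspace (surface X) - drawing X))) \<and>
     (\<forall>f. subtopology (surface X) (region X f) homeomorphic_space top_of_set (ball (0::complex) 1))"

text \<open>An arc that follows the clockwise boundary walk of a face has this face on its right. This is
  expressed by a positively oriented chart onto the unit disc which straightens a piece of the arc
  to the real diameter, traversed from left to right: the face on the right of the arc is the one
  containing the lower half disc.\<close>

definition right_of :: "('s, 'v, 'e, 'f) omap \<Rightarrow> 'e arc \<Rightarrow> 'f \<Rightarrow> bool" where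
  "right_of X a f \<longleftrightarrow>
     (\<exists>U \<phi> s t. positive_chart (surface X) (atlas X) U \<phi> \<and> \<phi> ` U = ball 0 1 \<and>
        0 \<le> s \<and> s < t \<and> t \<le> 1 \<and> drawing X \<inter> U = arc_curve X a ` {s<..<t} \<and>
        \<phi> ` (drawing X \<inter> U) = {z \<in> ball 0 1. Im z = 0} \<and>
        strict_mono_on {s<..<t} (\<lambda>x. Re (\<phi> (arc_curve X a x))) \<and>
        {x \<in> U. Im (\<phi> x) < 0} \<subseteq> region X f)"

definition arc_face :: "('s, 'v, 'e, 'f) omap \<Rightarrow> 'e arc \<Rightarrow> 'f" where
  "arc_face X a = (THE f. right_of X a f)"

definition vertex_degree :: "('s, 'v, 'e::finite, 'f) omap \<Rightarrow> 'v \<Rightarrow> nat" where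
  "vertex_degree X x = card {a. tail X a = x}"


section \<open>The vertex-face walk\<close>

definition N_mat :: "('s, 'v::finite, 'e::finite, 'f::finite) omap \<Rightarrow> complex ^ 'v ^ 'e arc" where
  "N_mat X = (\<chi> a x. if x = tail X a then 1 else 0)"

definition M_mat :: "('s, 'v::finite, 'e::finite, 'f::finite) omap \<Rightarrow> complex ^ 'f ^ 'e arc" where
  "M_mat X = (\<chi> a f. if f = arc_face X a then 1 else 0)"

definition D_mat :: "('s, 'v::finite, 'e::finite, 'f::finite) omap \<Rightarrow> complex ^ 'v ^ 'v" where
  "D_mat X = transpose (N_mat X) ** N_mat X"

definition Delta_mat :: "('s, 'v::finite, 'e::finite, 'f::finite) omap \<Rightarrow> complex ^ 'f ^ 'f" where
  "Delta_mat X = transpose (M_mat X) ** M_mat X"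

text \<open>The matrix \<open>A\<close> to the power \<open>-1/2\<close>, for a diagonal matrix \<open>A\<close> with positive diagonal.\<close>

definition diag_inv_sqrt :: "complex ^ 'n ^ 'n \<Rightarrow> complex ^ 'n ^ 'n" where
  "diag_inv_sqrt A = (\<chi> i j. if i = j then 1 / csqrt (A $ i $ i) else 0)"

definition N_hat :: "('s, 'v::finite, 'e::finite, 'f::finite) omap \<Rightarrow> complex ^ 'v ^ 'e arc" where
  "N_hat X = N_mat X ** diag_inv_sqrt (D_mat X)"

definition M_hat :: "('s, 'v::finite, 'e::finite, 'f::finite) omap \<Rightarrow> complex ^ 'f ^ 'e arc" where
  "M_hat X = M_mat X ** diag_inv_sqrt (Delta_mat X)"

definition Q_mat :: "('s, 'v::finite, 'e::finite, 'f::finite) omap \<Rightarrow> complex ^ 'e arc ^ 'e arc" where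
  "Q_mat X = N_hat X ** transpose (N_hat X)"

definition P_mat :: "('s, 'v::finite, 'e::finite, 'f::finite) omap \<Rightarrow> complex ^ 'e arc ^ 'e arc" where
  "P_mat X = M_hat X ** transpose (M_hat X)"

definition U_mat :: "('s, 'v::finite, 'e::finite, 'f::finite) omap \<Rightarrow> complex ^ 'e arc ^ 'e arc" where
  "U_mat X = (2 *\<^sub>R P_mat X - mat 1) ** (2 *\<^sub>R Q_mat X - mat 1)"

text \<open>The operation \<open>^\<close> on \<open>complex ^ 'n ^ 'n\<close> is the entrywise power.\<close>

primrec mat_pow :: "complex ^ 'n ^ 'n \<Rightarrow> nat \<Rightarrow> complex ^ 'n ^ 'n" where
  "mat_pow A 0 = mat 1"
| "mat_pow A (Suc k) = A ** mat_pow A k"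

definition B_mat :: "('s, 'v::finite, 'e::finite, 'f::finite) omap \<Rightarrow> nat \<Rightarrow> complex ^ 'v ^ 'v" where
  "B_mat X t = transpose (N_hat X) ** mat_pow (U_mat X) t ** N_hat X"

definition perfect_state_transfer ::
    "('s, 'v::finite, 'e::finite, 'f::finite) omap \<Rightarrow> 'v \<Rightarrow> 'v \<Rightarrow> nat \<Rightarrow> bool" where
  "perfect_state_transfer X u v \<tau> \<longleftrightarrow>
     u \<noteq> v \<and> vertex_degree X u = vertex_degree X v \<and> \<tau> > 0 \<and>
     mat_pow (U_mat X) \<tau> *v (N_hat X *v axis u 1) = N_hat X *v axis v 1"

definition periodic_at ::
    "('s, 'v::finite, 'e::finite, 'f::finite) omap \<Rightarrow> 'v \<Rightarrow> nat \<Rightarrow> bool" where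
  "periodic_at X u \<tau> \<longleftrightarrow>
     \<tau> > 0 \<and> mat_pow (U_mat X) \<tau> *v (N_hat X *v axis u 1) = N_hat X *v axis u 1"


section \<open>Strong cospectrality\<close>

definition hermitian :: "complex ^ 'n ^ 'n \<Rightarrow> bool" where
  "hermitian H \<longleftrightarrow> (\<forall>i j. H $ i $ j = cnj (H $ j $ i))"

text \<open>\<open>\<Theta>\<close> is the set of distinct eigenvalues and \<open>E \<theta>\<close> the orthogonal projection onto the eigenspace
  of \<open>\<theta>\<close>. Every Hermitian matrix has exactly one such decomposition, up to values of \<open>E\<close> outside
  \<open>\<Theta>\<close>, so that the quantification over all decompositions below is no restriction.\<close>

definition spectral_decomposition ::
    "complex ^ 'n ^ 'n \<Rightarrow> real set \<Rightarrow> (real \<Rightarrow> complex ^ 'n ^ 'n) \<Rightarrow> bool" where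
  "spectral_decomposition H \<Theta> E \<longleftrightarrow>
     finite \<Theta> \<and>
     (\<forall>\<theta>\<in>\<Theta>. E \<theta> \<noteq> 0 \<and> hermitian (E \<theta>) \<and> E \<theta> ** E \<theta> = E \<theta>) \<and>
     (\<forall>\<theta>\<in>\<Theta>. \<forall>\<eta>\<in>\<Theta>. \<theta> \<noteq> \<eta> \<longrightarrow> E \<theta> ** E \<eta> = 0) \<and>
     (\<Sum>\<theta>\<in>\<Theta>. E \<theta>) = mat 1 \<and>
     H = (\<Sum>\<theta>\<in>\<Theta>. \<theta> *\<^sub>R E \<theta>)"

definition strongly_cospectral :: "complex ^ 'n ^ 'n \<Rightarrow> 'n \<Rightarrow> 'n \<Rightarrow> bool" where
  "strongly_cospectral H u v \<longleftrightarrow>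
     hermitian H \<and>
     (\<forall>\<Theta> E. spectral_decomposition H \<Theta> E \<longrightarrow>
        (\<forall>\<theta>\<in>\<Theta>. E \<theta> *v axis v 1 = E \<theta> *v axis u 1 \<or> E \<theta> *v axis v 1 = - (E \<theta> *v axis u 1)))"

end

theory Submission
  imports Defs
begin

text \<open>Write \<open>U = RS\<close> with \<open>R = 2P - I\<close> and \<open>S = 2Q - I\<close>, both real symmetric involutions, where
  \<open>S\<close> fixes the columns of \<open>K\<close>, the matrix \<open>N_hat\<close>. Then \<open>U\<^sup>n S U\<^sup>n = S\<close>, that is, \<open>S\<close> reverses the
  walk. Reversal turns \<open>U\<^sup>\<tau> K e\<^sub>u = K e\<^sub>v\<close> into \<open>U\<^sup>\<tau> K e\<^sub>v = K e\<^sub>u\<close>, whence (i) and (ii). Any state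
  that is reached from \<open>K e\<^sub>u\<close> and, by (i), returns to it after the same time is reached at half
  of the minimal period, so it is unique, which is (iii). Finally \<open>2 K K\<^sup>T = S + I\<close> gives the Chebyshev
  recurrence \<open>2 B\<^sub>d B\<^bsub>t+d\<^esub> = B\<^bsub>t+2d\<^esub> + B\<^sub>t\<close>, so the spectral idempotents \<open>E\<close> of \<open>B\<^sub>d\<close> satisfy
  \<open>E B\<^sub>\<tau> = c E\<close> for real \<open>c\<close>. As \<open>B\<^sub>\<tau>\<close> swaps \<open>e\<^sub>u\<close> and \<open>e\<^sub>v\<close>, either \<open>c = \<plusminus>1\<close> or \<open>E e\<^sub>u = E e\<^sub>v = 0\<close>,
  which is (iv).\<close>

section \<open>Matrices\<close>

lemma matrix_add_rdistrib: "(A + B) ** C = A ** C + B ** C"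
  by (vector matrix_matrix_mult_def sum.distrib[symmetric] distrib_right)

lemma matrix_diff_ldistrib:
  fixes A :: "'a::ring_1^'n^'m"
  shows "A ** (B - C) = A ** B - A ** C"
  by (vector matrix_matrix_mult_def sum_subtractf[symmetric] right_diff_distrib)

lemma matrix_diff_rdistrib:
  fixes A :: "'a::ring_1^'n^'m"
  shows "(A - B) ** C = A ** C - B ** C"
  by (vector matrix_matrix_mult_def sum_subtractf[symmetric] left_diff_distrib)

lemma transpose_diff: "transpose (A - B) = transpose A - transpose B"
  by (simp add: transpose_def vec_eq_iff)

lemma matrix_mult_sum_right:
  fixes A :: "'a::semiring_1^'n^'m"
  assumes "finite I"
  shows "A ** (\<Sum>i\<in>I. F i) = (\<Sum>i\<in>I. A ** F i)"
  using assms by induction (simp_all add: matrix_add_ldistrib)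

lemma scaleR_matrix_vector: "(c *\<^sub>R A) *v x = c *\<^sub>R (A *v (x :: 'a::real_algebra_1 ^ 'n))"
  by (simp add: matrix_vector_mult_def vec_eq_iff scaleR_sum_right)

lemma mat_pow_commute: "mat_pow A n ** A = A ** mat_pow A n"
  by (induction n) (simp_all add: matrix_mul_assoc[symmetric])

lemma mat_pow_add: "mat_pow A (m + n) = mat_pow A m ** mat_pow A n"
  by (induction m) (simp_all add: matrix_mul_assoc)

lemma mat_pow_mult_vec: "mat_pow A n *v x = (((*v) A) ^^ n) x"
  by (induction n) (simp_all flip: matrix_vector_mul_assoc)

text \<open>\<open>transpose\<close> does not conjugate, so reality of the entries is what turns
  symmetry into \<open>hermitian\<close>.\<close>

definition real_matrix :: "complex ^ 'n ^ 'm \<Rightarrow> bool" where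
  "real_matrix A \<longleftrightarrow> (\<forall>i j. A $ i $ j \<in> \<real>)"

lemma real_matrix_mult: "real_matrix A \<Longrightarrow> real_matrix B \<Longrightarrow> real_matrix (A ** B)"
  by (auto simp: real_matrix_def matrix_matrix_mult_def intro!: sum_in_Reals Reals_mult)

lemma real_matrix_transpose: "real_matrix A \<Longrightarrow> real_matrix (transpose A)"
  by (simp add: real_matrix_def transpose_def)

lemma real_matrix_mat_1: "real_matrix (mat 1)"
  by (simp add: real_matrix_def mat_def)

lemma real_matrix_reflection: "real_matrix A \<Longrightarrow> real_matrix (2 *\<^sub>R A - mat 1)"
  by (auto simp: real_matrix_def mat_def scaleR_conv_of_real intro!: Reals_diff Reals_mult)

lemma real_matrix_mat_pow: "real_matrix A \<Longrightarrow> real_matrix (mat_pow A n)"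
  by (induction n) (simp_all add: real_matrix_mat_1 real_matrix_mult)

lemma hermitian_real_symmetric:
  assumes "real_matrix A" "transpose A = A"
  shows "hermitian A"
  unfolding hermitian_def
proof (intro allI)
  fix i j
  have "A $ i $ j = A $ j $ i"
    using assms(2) by (metis transpose_def vec_lambda_beta)
  then show "A $ i $ j = cnj (A $ j $ i)"
    using assms(1) by (simp add: real_matrix_def Reals_cnj_iff)
qed

lemma reflection_involution:
  fixes A :: "complex ^ 'n ^ 'n"
  assumes "A ** A = A"
  shows "(2 *\<^sub>R A - mat 1) ** (2 *\<^sub>R A - mat 1) = mat 1"
  by (simp add: matrix_diff_ldistrib matrix_diff_rdistrib matrix_scalar_ac assms
      flip: scalar_matrix_assoc) (simp only: scaleR_2 mult_2)

lemma reflection_symmetric: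
  fixes A :: "complex ^ 'n ^ 'n"
  assumes "transpose A = A"
  shows "transpose (2 *\<^sub>R A - mat 1) = 2 *\<^sub>R A - mat 1"
  by (simp add: transpose_diff transpose_scalar assms)


section \<open>Walks given by two reflections\<close>

text \<open>The faces enter the argument only through these properties of \<open>R\<close>. The
  isometry \<open>K\<close> stands for \<open>N_hat X\<close>.\<close>

locale reflection_walk =
  fixes R :: "complex ^ 'a::finite ^ 'a" and K :: "complex ^ 'n::finite ^ 'a"
  assumes R_involution: "R ** R = mat 1" and R_symmetric: "transpose R = R"
    and K_isometry: "transpose K ** K = mat 1"
    and R_real: "real_matrix R" and K_real: "real_matrix K"
begin

definition S where "S = 2 *\<^sub>R (K ** transpose K) - mat 1"
definition U where "U = R ** S"
definition B where "B t = transpose K ** mat_pow U t ** K"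

lemma S_involution: "S ** S = mat 1"
  unfolding S_def
  by (rule reflection_involution) (metis K_isometry matrix_mul_assoc matrix_mul_rid)

lemma S_symmetric: "transpose S = S"
  unfolding S_def by (rule reflection_symmetric) (simp add: matrix_transpose_mul)

lemma S_K: "S ** K = K"
  by (simp add: S_def matrix_diff_rdistrib K_isometry flip: scalar_matrix_assoc matrix_mul_assoc)
     (simp only: scaleR_2 mult_2)

lemma K_S: "transpose K ** S = transpose K"
  by (metis S_K S_symmetric matrix_transpose_mul)

lemma U_S_U: "U ** S ** U = S"
  by (metis U_def R_involution S_involution matrix_mul_assoc matrix_mul_rid matrix_mul_lid)

text \<open>One factor \<open>U\<close> is peeled off at each outer end; the rest is the induction
  hypothesis, and \<open>U ** S ** U\<close> collapses because \<open>R\<close> and \<open>S\<close>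
  are involutions.\<close>

lemma pow_S_pow: "mat_pow U n ** S ** mat_pow U n = S"
proof (induction n)
  case (Suc n)
  have "mat_pow U (Suc n) ** S ** mat_pow U (Suc n)
      = U ** (mat_pow U n ** S ** mat_pow U n) ** U"
    by (simp add: matrix_mul_assoc mat_pow_commute flip: mat_pow_commute)
  then show ?case
    by (simp add: Suc.IH U_S_U)
qed simp

text \<open>The transpose of \<open>U\<close> is \<open>S ** R\<close>, hence
  \<open>S ** U ** S\<close>; in a product of such conjugates the inner pairs \<open>S ** S\<close>
  cancel.\<close>

lemma transpose_pow: "transpose (mat_pow U n) = S ** mat_pow U n ** S"
proof (induction n)
  case (Suc n)
  have "transpose U = S ** U ** S"
    by (metis U_def R_symmetric S_symmetric S_involution matrix_transpose_mul
        matrix_mul_assoc matrix_mul_rid)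
  then have "transpose (mat_pow U (Suc n)) = S ** mat_pow U n ** (S ** S) ** U ** S"
    by (simp add: matrix_transpose_mul Suc.IH matrix_mul_assoc)
  also have "\<dots> = S ** mat_pow U (Suc n) ** S"
    by (simp add: S_involution mat_pow_commute flip: matrix_mul_assoc)
  finally show ?case .
qed (simp add: S_involution)

lemma hermitian_B: "hermitian (B t)"
proof (rule hermitian_real_symmetric)
  have "real_matrix U"
    by (simp add: U_def S_def R_real K_real real_matrix_mult real_matrix_transpose
        real_matrix_reflection)
  then show "real_matrix (B t)"
    by (simp add: B_def K_real real_matrix_mult real_matrix_transpose real_matrix_mat_pow)
  \<comment> \<open>The outer factors \<open>S\<close> left by \<open>transpose_pow\<close> are
    absorbed by \<open>K\<close>.\<close>
  have "transpose (B t) = (transpose K ** S) ** mat_pow U t ** (S ** K)"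
    by (simp add: B_def matrix_transpose_mul transpose_pow matrix_mul_assoc)
  then show "transpose (B t) = B t"
    by (simp add: K_S S_K B_def)
qed

lemma B_0: "B 0 = mat 1"
  by (simp add: B_def K_isometry)

text \<open>Between the two powers, \<open>mat 1\<close> merges them into \<open>U\<close> to the
  power \<open>t + 2 * d\<close>, while \<open>S\<close> leaves \<open>S ** mat_pow U t\<close> by
  \<open>pow_S_pow\<close>. The shift \<open>t + d\<close> avoids subtraction of naturals.\<close>

lemma B_recurrence: "2 *\<^sub>R (B d ** B (t + d)) = B (t + 2 * d) + B t"
proof -
  have "2 *\<^sub>R (B d ** B (t + d))
      = transpose K ** mat_pow U d ** (2 *\<^sub>R (K ** transpose K)) ** mat_pow U (t + d) ** K"
    by (simp add: B_def matrix_scalar_ac matrix_mul_assoc flip: scalar_matrix_assoc)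
  also have "2 *\<^sub>R (K ** transpose K) = mat 1 + S"
    by (simp add: S_def)
  also have "transpose K ** mat_pow U d ** (mat 1 + S) ** mat_pow U (t + d) ** K
      = transpose K ** (mat_pow U d ** mat_pow U (t + d)) ** K
        + transpose K ** (mat_pow U d ** S ** mat_pow U d) ** mat_pow U t ** K"
    by (simp add: matrix_add_ldistrib matrix_add_rdistrib matrix_mul_assoc mat_pow_add
        add.commute[of t])
  also have "mat_pow U d ** mat_pow U (t + d) = mat_pow U (t + 2 * d)"
    by (simp add: mult_2 add.left_commute flip: mat_pow_add)
  finally show ?thesis
    by (simp add: pow_S_pow K_S B_def)
qed

text \<open>By the recurrence \<open>B (m * d)\<close> is the Chebyshev polynomial of the first kind
  \<open>T_m\<close> evaluated at \<open>B d\<close>, so \<open>c\<close> is \<open>T_m\<close> at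
  \<open>\<theta>\<close>.\<close>

lemma eigenprojection_B:
  assumes "E ** B d = \<theta> *\<^sub>R E"
  shows "\<exists>c::real. E ** B (m * d) = c *\<^sub>R E"
proof (induction m rule: induct_nat_012)
  case 0
  have "E ** B (0 * d) = 1 *\<^sub>R E"
    by (simp add: B_0)
  then show ?case by blast
next
  case 1
  show ?case using assms by auto
next
  case (ge2 m)
  then obtain b c where b: "E ** B (m * d) = b *\<^sub>R E" and c: "E ** B (Suc m * d) = c *\<^sub>R E"
    by blast
  have "B (Suc (Suc m) * d) = 2 *\<^sub>R (B d ** B (Suc m * d)) - B (m * d)"
  proof -
    have "Suc m * d = m * d + d" "Suc (Suc m) * d = m * d + 2 * d"
      by simp_all
    then show ?thesis
      using B_recurrence[of d "m * d"] by (simp only: eq_diff_eq)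
  qed
  then have "E ** B (Suc (Suc m) * d) = 2 *\<^sub>R (E ** B d ** B (Suc m * d)) - E ** B (m * d)"
    by (simp add: matrix_diff_ldistrib matrix_scalar_ac matrix_mul_assoc del: mult_Suc
        flip: scalar_matrix_assoc)
  also have "\<dots> = (2 * \<theta> * c - b) *\<^sub>R E"
    by (simp add: assms b c scaleR_diff_left del: mult_Suc flip: scalar_matrix_assoc)
  finally show ?case by blast
qed

text \<open>\<open>S\<close> fixes every state \<open>K *v z\<close>, so it can be inserted between
  two runs of the walk, where \<open>pow_S_pow\<close> cancels both runs.\<close>

lemma walk_reverse:
  assumes "mat_pow U t *v (K *v x) = K *v y"
  shows "mat_pow U t *v (K *v y) = K *v x"
proof -
  have fixed: "S *v (K *v z) = K *v z" for z
    by (simp add: matrix_vector_mul_assoc S_K)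
  have "mat_pow U t *v (K *v y) = mat_pow U t *v (S *v (mat_pow U t *v (K *v x)))"
    by (simp add: assms fixed)
  also have "\<dots> = S *v (K *v x)"
    unfolding matrix_vector_mul_assoc by (simp only: matrix_mul_assoc pow_S_pow)
  finally show ?thesis
    by (simp add: fixed)
qed

lemma K_inj: "K *v x = K *v y \<longleftrightarrow> x = y"
  by (metis K_isometry matrix_vector_mul_assoc matrix_vector_mul_lid)

lemma B_transfer:
  assumes "mat_pow U t *v (K *v x) = K *v y"
  shows "B t *v x = y"
proof -
  have "B t *v x = transpose K *v (mat_pow U t *v (K *v x))"
    by (simp only: B_def matrix_vector_mul_assoc matrix_mul_assoc)
  also have "\<dots> = y"
    unfolding assms by (simp only: matrix_vector_mul_assoc K_isometry matrix_vector_mul_lid)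
  finally show ?thesis .
qed

lemma strongly_cospectral_B:
  assumes transfer: "mat_pow U \<tau> *v (K *v axis u 1) = K *v axis v 1"
    and "d dvd \<tau>"
  shows "strongly_cospectral (B d) u v"
  unfolding strongly_cospectral_def
proof (intro conjI allI impI ballI)
  show "hermitian (B d)" by (rule hermitian_B)
next
  fix \<Theta> E \<theta>
  assume dec: "spectral_decomposition (B d) \<Theta> E" and \<theta>: "\<theta> \<in> \<Theta>"
  obtain m where \<tau>: "\<tau> = m * d"
    using \<open>d dvd \<tau>\<close> by (metis dvd_def mult.commute)
  have fin: "finite \<Theta>" and B: "B d = (\<Sum>\<eta>\<in>\<Theta>. \<eta> *\<^sub>R E \<eta>)"
    using dec by (auto simp: spectral_decomposition_def)
  have "E \<theta> ** B d = (\<Sum>\<eta>\<in>\<Theta>. \<eta> *\<^sub>R (E \<theta> ** E \<eta>))"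
    by (simp add: B matrix_mult_sum_right[OF fin] matrix_scalar_ac
        flip: scalar_matrix_assoc)
  also have "\<dots> = (\<Sum>\<eta>\<in>\<Theta>. if \<eta> = \<theta> then \<theta> *\<^sub>R E \<theta> else 0)"
    using dec \<theta> by (intro sum.cong) (auto simp: spectral_decomposition_def)
  also have "\<dots> = \<theta> *\<^sub>R E \<theta>"
    using fin \<theta> by simp
  finally obtain c where c: "E \<theta> ** B \<tau> = c *\<^sub>R E \<theta>"
    using eigenprojection_B \<tau> by metis
  have scaled: "E \<theta> *v (B \<tau> *v x) = c *\<^sub>R (E \<theta> *v x)" for x
    by (simp add: matrix_vector_mul_assoc c scaleR_matrix_vector)
  have uv: "E \<theta> *v axis v 1 = c *\<^sub>R (E \<theta> *v axis u 1)"
    using scaled[of "axis u 1"] B_transfer[OF transfer] by simp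
  have vu: "E \<theta> *v axis u 1 = c *\<^sub>R (E \<theta> *v axis v 1)"
    using scaled[of "axis v 1"] B_transfer[OF walk_reverse[OF transfer]] by simp
  have "(c * c) *\<^sub>R (E \<theta> *v axis u 1) = E \<theta> *v axis u 1"
    using uv vu by (metis scaleR_scaleR)
  then have "(c * c - 1) *\<^sub>R (E \<theta> *v axis u 1) = 0"
    by (simp only: scaleR_diff_left scaleR_one right_minus_eq)
  \<comment> \<open>In the third case the projection of \<open>axis v 1\<close> vanishes as well,
    being a multiple of that of \<open>axis u 1\<close>.\<close>
  then have "c = 1 \<or> c = -1 \<or> E \<theta> *v axis u 1 = 0"
    using square_eq_1_iff[of c] by auto
  then show "E \<theta> *v axis v 1 = E \<theta> *v axis u 1 \<or> E \<theta> *v axis v 1 = - (E \<theta> *v axis u 1)"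
    using uv by auto
qed

end

text \<open>Let \<open>k\<close> be the minimal period of \<open>x\<close>. It divides
  \<open>2 * m\<close> but not \<open>m\<close>, so \<open>m mod k\<close> is half of
  \<open>k\<close>. The same holds for \<open>n\<close>, and equal residues give equal
  states.\<close>

lemma funpow_half_period_unique:
  assumes y: "(f ^^ m) x = y" "(f ^^ m) y = x" "y \<noteq> x"
    and z: "(f ^^ n) x = z" "(f ^^ n) z = x" "z \<noteq> x"
  shows "y = z"
proof -
  define k where "k = (LEAST k. k > 0 \<and> (f ^^ k) x = x)"
  have "m \<noteq> 0"
    using y by (metis funpow_0)
  moreover have "(f ^^ (m + m)) x = x"
    using y by (simp add: funpow_add)
  ultimately have k: "k > 0" "(f ^^ k) x = x"
    using LeastI[of "\<lambda>k. k > 0 \<and> (f ^^ k) x = x" "m + m"] by (auto simp: k_def)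
  have least: "k \<le> i" if "i > 0" "(f ^^ i) x = x" for i
    unfolding k_def using that by (intro Least_le) simp
  have half: "2 * (i mod k) = k" if "(f ^^ i) x = w" "(f ^^ i) w = x" "w \<noteq> x" for i w
  proof -
    let ?r = "i mod k"
    have r: "(f ^^ ?r) x = w"
      using funpow_mod_eq[OF k(2)] that by metis
    then have r0: "?r \<noteq> 0"
      using that by (metis funpow_0)
    have "(f ^^ (i + i)) x = x"
      using that by (simp add: funpow_add)
    then have "(f ^^ ((i + i) mod k)) x = x"
      using funpow_mod_eq[OF k(2)] by metis
    \<comment> \<open>A nonzero remainder would be a period smaller than \<open>k\<close>.\<close>
    then have "(i + i) mod k = 0"
      using least k(1) by (metis mod_less_divisor not_gr_zero not_le)
    then have "k dvd ?r + ?r"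
      by (simp add: dvd_eq_mod_eq_0 mod_add_eq)
    then obtain q where q: "?r + ?r = k * q" ..
    have "?r < k"
      using k by simp
    then have "k * q < k * 2"
      unfolding q[symmetric] by linarith
    moreover have "q \<noteq> 0"
      using q r0 by (metis add_is_0 mult_0_right)
    ultimately have "q = 1"
      by simp
    then show ?thesis
      using q by simp
  qed
  have "m mod k = n mod k"
    using half[OF y] half[OF z] by linarith
  then show ?thesis
    using y(1) z(1) funpow_mod_eq[OF k(2)] by metis
qed


section \<open>Incidence matrices\<close>

text \<open>Common form of \<open>N_mat\<close> and \<open>M_mat\<close>, with \<open>g\<close> the
  tail map or the face map of the arcs.\<close>

definition incidence :: "('a::finite \<Rightarrow> 'c::finite) \<Rightarrow> complex ^ 'c ^ 'a" where
  "incidence g = (\<chi> a c. if c = g a then 1 else 0)"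

definition normalized_incidence :: "('a::finite \<Rightarrow> 'c::finite) \<Rightarrow> complex ^ 'c ^ 'a" where
  "normalized_incidence g =
     incidence g ** diag_inv_sqrt (transpose (incidence g) ** incidence g)"

lemma mult_diag_inv_sqrt_nth:
  "(A ** diag_inv_sqrt H) $ i $ j = A $ i $ j / csqrt (H $ j $ j)"
  by (simp add: matrix_matrix_mult_def diag_inv_sqrt_def if_distrib cong: if_cong)

lemma normalized_incidence_nth:
  "normalized_incidence g $ a $ c =
     (if c = g a then complex_of_real (1 / sqrt (card {b. g b = c})) else 0)"
proof -
  have "(transpose (incidence g) ** incidence g) $ c $ c = of_nat (card {b. g b = c})" for c
    by (simp add: matrix_matrix_mult_def transpose_def incidence_def if_distrib sum.If_cases
        eq_commute[of c] cong: if_cong)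
  then show ?thesis
    by (simp add: normalized_incidence_def mult_diag_inv_sqrt_nth) (simp add: incidence_def)
qed

lemma real_matrix_normalized_incidence: "real_matrix (normalized_incidence g)"
  by (simp add: real_matrix_def normalized_incidence_nth)

lemma normalized_incidence_gram:
  "(transpose (normalized_incidence g) ** normalized_incidence g) $ c $ c' =
     (if c = c' \<and> c \<in> range g then 1 else 0)"
proof -
  let ?n = "card {b. g b = c}"
  have "(transpose (normalized_incidence g) ** normalized_incidence g) $ c $ c' =
      (\<Sum>a\<in>UNIV. if g a = c then if c = c' then complex_of_real (1 / ?n) else 0 else 0)"
    by (auto simp: matrix_matrix_mult_def transpose_def normalized_incidence_nth
        simp flip: of_real_mult intro!: sum.cong sum.neutral)
  also have "\<dots> = (if c = c' then of_nat ?n * complex_of_real (1 / ?n) else 0)"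
    by (simp add: sum.If_cases)
  also have "?n = 0 \<longleftrightarrow> c \<notin> range g"
    by auto
  then have "(if c = c' then of_nat ?n * complex_of_real (1 / ?n) else 0) =
      (if c = c' \<and> c \<in> range g then 1 else 0)"
    by auto
  finally show ?thesis .
qed

lemma normalized_incidence_isometry:
  "surj g \<Longrightarrow> transpose (normalized_incidence g) ** normalized_incidence g = mat 1"
  by (simp add: vec_eq_iff normalized_incidence_gram mat_def)

text \<open>A column of \<open>H\<close> over an empty fibre of \<open>g\<close> is zero and the
  other columns are orthonormal, so \<open>H ** (transpose H ** H) = H\<close>. This treats
  \<open>P_mat\<close> whatever the range of \<open>arc_face\<close>.\<close>

lemma normalized_incidence_projection:
  fixes g :: "'a::finite \<Rightarrow> 'c::finite"
  defines "H \<equiv> normalized_incidence g"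
  shows "(H ** transpose H) ** (H ** transpose H) = H ** transpose H"
proof -
  have "(H ** (transpose H ** H)) $ a $ c = H $ a $ c" for a c
  proof -
    have "(H ** (transpose H ** H)) $ a $ c =
        (\<Sum>b\<in>UNIV. H $ a $ b * (transpose H ** H) $ b $ c)"
      by (simp only: matrix_matrix_mult_def[of H] vec_lambda_beta)
    also have "\<dots> =
        (\<Sum>b\<in>UNIV. if b = c then H $ a $ c * (if c \<in> range g then 1 else 0) else 0)"
      by (intro sum.cong) (auto simp: normalized_incidence_gram H_def)
    also have "\<dots> = H $ a $ c"
      by (auto simp: H_def normalized_incidence_nth)
    finally show ?thesis .
  qed
  then have "H ** (transpose H ** H) = H"
    by (simp add: vec_eq_iff)
  then show ?thesis
    by (metis matrix_mul_assoc)
qed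


section \<open>Perfect state transfer\<close>

lemma N_hat_eq: "N_hat X = normalized_incidence (tail X)"
  by (simp add: N_hat_def D_mat_def N_mat_def normalized_incidence_def incidence_def)

lemma M_hat_eq: "M_hat X = normalized_incidence (arc_face X)"
  by (simp add: M_hat_def Delta_mat_def M_mat_def normalized_incidence_def incidence_def)

text \<open>A path from \<open>x\<close> to a different vertex must start with an arc whose tail is
  \<open>x\<close>; the distinct \<open>u\<close> and \<open>v\<close> provide such a
  vertex.\<close>

lemma surj_tail:
  fixes X :: "('s, 'v, 'e, 'f) omap" and u v :: 'v
  assumes "connected_multigraph X" "u \<noteq> v"
  shows "surj (tail X)"
proof -
  have "x \<in> range (tail X)" for x
  proof -
    obtain y where "y \<noteq> x"
      using \<open>u \<noteq> v\<close> by metis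
    moreover have "(x, y) \<in> (range (\<lambda>a. (tail X a, head X a)))\<^sup>*"
      using assms(1) by (simp add: connected_multigraph_def)
    ultimately show ?thesis
      by (auto elim: converse_rtranclE)
  qed
  then show ?thesis by blast
qed

theorem theorem4p5:
  fixes X :: "('s, 'v::finite, 'e::finite, 'f::finite) omap"
    and u v :: 'v and \<tau> :: nat
  assumes "orientable_map X"
    and "u \<noteq> v" and "vertex_degree X u = vertex_degree X v"
    and "\<tau> > 0" and "perfect_state_transfer X u v \<tau>"
  shows "perfect_state_transfer X v u \<tau> \<and>
    (periodic_at X u (2 * \<tau>) \<and> periodic_at X v (2 * \<tau>)) \<and>
    \<not> (\<exists>w \<sigma>. w \<noteq> u \<and> w \<noteq> v \<and> perfect_state_transfer X u w \<sigma>) \<and>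
    (\<forall>d. d > 0 \<and> d dvd \<tau> \<longrightarrow> strongly_cospectral (B_mat X d) u v)"
proof -
  define R where "R = 2 *\<^sub>R P_mat X - mat 1"
  have "surj (tail X)"
    using assms(1,2) by (intro surj_tail) (simp_all add: orientable_map_def)
  \<comment> \<open>Surjectivity of \<open>tail X\<close> makes \<open>N_hat X\<close> an isometry;
    \<open>R\<close> is an involution because \<open>P_mat X\<close> is a projection.\<close>
  then interpret reflection_walk R "N_hat X"
    by unfold_locales
      (simp_all add: R_def P_mat_def N_hat_eq M_hat_eq normalized_incidence_projection
        normalized_incidence_isometry reflection_involution reflection_symmetric
        matrix_transpose_mul real_matrix_reflection real_matrix_mult real_matrix_transpose
        real_matrix_normalized_incidence)
  have U: "U_mat X = U"
    by (simp add: U_mat_def U_def S_def Q_mat_def flip: R_def)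
  have B: "B_mat X d = B d" for d
    by (simp add: B_mat_def B_def U)
  let ?x = "\<lambda>w. N_hat X *v axis w 1"
  have inj: "?x w = ?x w' \<longleftrightarrow> w = w'" for w w'
    by (simp add: K_inj axis_eq_axis)
  have uv: "mat_pow U \<tau> *v ?x u = ?x v"
    using assms(5) by (simp add: perfect_state_transfer_def U)
  note vu = walk_reverse[OF uv]
  have "w = v" if "perfect_state_transfer X u w \<sigma>" for w \<sigma>
  proof -
    have "u \<noteq> w" and uw: "mat_pow U \<sigma> *v ?x u = ?x w"
      using that by (auto simp: perfect_state_transfer_def U)
    \<comment> \<open>By reversal both targets return to \<open>?x u\<close> after the same number
      of steps, so both sit at half of its minimal period.\<close>
    then have "?x v = ?x w"
      using funpow_half_period_unique[of \<tau> "(*v) U" "?x u" "?x v" \<sigma> "?x w"]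
        uv vu uw walk_reverse[OF uw] \<open>u \<noteq> v\<close> by (simp add: mat_pow_mult_vec inj)
    then show ?thesis
      by (simp add: inj)
  qed
  moreover have "perfect_state_transfer X v u \<tau>"
    using assms vu by (simp add: perfect_state_transfer_def U)
  \<comment> \<open>Two consecutive transfers, there and back.\<close>
  moreover have "periodic_at X u (2 * \<tau>)" "periodic_at X v (2 * \<tau>)"
    using uv vu \<open>\<tau> > 0\<close>
    by (simp_all add: periodic_at_def U mult_2 mat_pow_add flip: matrix_vector_mul_assoc)
  moreover have "strongly_cospectral (B_mat X d) u v" if "d dvd \<tau>" for d
    using strongly_cospectral_B[OF uv that] by (simp add: B)
  ultimately show ?thesis
    by blast
qed

end
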